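(* For all sufficiently large $\lambda>1$ (i.e. there is $\lambda_0>1$ such that for every $\lambda\ge\lambda_0$) there is a solution $w(x,t)$ of the mean curvature flow of graphs on $\mathbb{R}\times[0,\infty)$ with $$3\lambda<\|w(\cdot,0)\|_\infty\le 4\lambda$$ and $$\lambda\, e^{\lambda^2}\le \max_{|x|\le e^{-\lambda^2}}|dw(x,1)| .$$
   Context: Here the spatial dimension is $n=1$. A solution $w:\mathbb{R}\times[0,\infty)\to\mathbb{R}$ of the mean curvature flow of graphs is a smooth function whose graph flows by mean curvature, i.e. $w_t=(1+|dw|^2)^{1/2}\,\frac{d}{dx}\left(\frac{w_x}{(1+|dw|^2)^{1/2}}\right)$, equivalently $w_t=\frac{w_{xx}}{1+w_x^2}$. $dw=w_x$ denotes the derivative in the spatial variable $x$, and $\|\cdot\|_\infty$ is the sup norm (over $x\in\mathbb{R}$). *)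

theory Defs
  imports "HOL-Analysis.Analysis"
begin

text \<open>
  Smoothness on \<open>S\<close> includes the boundary points that belong to \<open>S\<close>. The notion is
  meant for sets such as a closed half-plane, where the derivative within \<open>S\<close> is unique at
  every point of \<open>S\<close>; on other sets it would depend on the choice of that derivative.
\<close>

primrec Ck_on :: "nat \<Rightarrow> 'a::real_normed_vector set \<Rightarrow> ('a \<Rightarrow> 'b::real_normed_vector) \<Rightarrow> bool" where
  "Ck_on 0 S f \<longleftrightarrow> continuous_on S f"
| "Ck_on (Suc k) S f \<longleftrightarrow>
     f differentiable_on S \<and> (\<forall>v. Ck_on k S (\<lambda>p. frechet_derivative f (at p within S) v))"

definition smooth_on :: "'a::real_normed_vector set \<Rightarrow> ('a \<Rightarrow> 'b::real_normed_vector) \<Rightarrow> bool" where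
  "smooth_on S f \<longleftrightarrow> (\<forall>k. Ck_on k S f)"

definition spatial_deriv :: "(real \<Rightarrow> real \<Rightarrow> real) \<Rightarrow> real \<Rightarrow> real \<Rightarrow> real" where
  "spatial_deriv w x t = deriv (\<lambda>y. w y t) x"

text \<open>
  The first argument of \<open>w\<close> is space, the second is time. Values of \<open>w\<close> at negative times are
  irrelevant, as all time derivatives are taken within \<open>{0..}\<close>.
\<close>

definition graphical_mcf :: "(real \<Rightarrow> real \<Rightarrow> real) \<Rightarrow> bool" where
  "graphical_mcf w \<longleftrightarrow>
     smooth_on (UNIV \<times> {0..}) (\<lambda>(x, t). w x t) \<and>
     (\<forall>x. \<forall>t\<ge>0.
        ((\<lambda>s. w x s) has_real_derivative
           sqrt (1 + (spatial_deriv w x t)\<^sup>2) *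
           deriv (\<lambda>y. spatial_deriv w y t / sqrt (1 + (spatial_deriv w y t)\<^sup>2)) x)
        (at t within {0..}))"

text \<open>
  The supremum is taken in the extended reals, so that it is \<open>\<infinity>\<close> for unbounded functions. For a
  continuous \<open>f\<close> on a nonempty compact \<open>S\<close> it is the maximum of \<open>\<bar>f\<bar>\<close> on \<open>S\<close>.
\<close>

definition sup_norm_on :: "'a set \<Rightarrow> ('a \<Rightarrow> real) \<Rightarrow> ereal" where
  "sup_norm_on S f = (SUP x\<in>S. ereal \<bar>f x\<bar>)"

end

theory Submission
  imports Defs
begin

text \<open>
  The equation \<open>sinh w = exp (- t) * sin x\<close> defines an entire graph that moves by mean curvature
  (the hairclip solution of curve shortening). Its parabolic rescalings
  \<open>arsinh (A * exp (- m\<^sup>2 * t) * sin (m * x)) / m\<close> have height \<open>arsinh A / m\<close> at time \<open>0\<close> and slope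
  \<open>A * exp (- m\<^sup>2)\<close> at the origin at time \<open>1\<close>. With \<open>A = sinh (7 * \<lambda>\<^sup>2)\<close> and \<open>m = 2 * \<lambda>\<close> the height is
  \<open>7 * \<lambda> / 2\<close> and the slope is about \<open>exp (3 * \<lambda>\<^sup>2) / 2\<close>.
\<close>

section \<open>Smoothness of elementary functions\<close>

text \<open>At a point of \<open>S\<close>, the derivative within \<open>S\<close> depends only on
  values on \<open>S\<close>. The induction in \<open>smooth_on_coinduct\<close> uses this to
  replace a \<open>frechet_derivative\<close> by an explicit derivative known only on
  \<open>S\<close>.\<close>

lemma Ck_on_cong:
  assumes "\<And>p. p \<in> S \<Longrightarrow> f p = g p"
  shows "Ck_on k S f \<longleftrightarrow> Ck_on k S g"
  using assms
proof (induction k arbitrary: f g)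
  case 0
  then show ?case by (simp cong: continuous_on_cong)
next
  case (Suc k)
  have has: "(f has_derivative D) (at p within S) \<longleftrightarrow> (g has_derivative D) (at p within S)"
    if "p \<in> S" for p D
    using that Suc.prems
    by (intro iffI; elim has_derivative_transform[rotated 2]) simp_all
  then have "frechet_derivative f (at p within S) = frechet_derivative g (at p within S)"
    if "p \<in> S" for p
    using that by (simp add: frechet_derivative_def)
  then have "Ck_on k S (\<lambda>p. frechet_derivative f (at p within S) v)
      \<longleftrightarrow> Ck_on k S (\<lambda>p. frechet_derivative g (at p within S) v)" for v
    by (intro Suc.IH) simp
  with has show ?case
    by (simp add: differentiable_on_def differentiable_def)
qed

text \<open>A family of differentiable functions closed under directional derivatives consists of
  smooth functions: induction on \<open>k\<close> for all members at once. No higher derivative has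
  to be computed.\<close>

lemma smooth_on_coinduct:
  fixes f :: "'a::real_normed_vector \<Rightarrow> 'b::real_normed_vector"
  assumes "f \<in> F"
    and deriv: "\<And>f. f \<in> F \<Longrightarrow> \<exists>f'. (\<forall>p\<in>S. (f has_derivative f' p) (at p within S)) \<and>
                                   (\<forall>v. (\<lambda>p. f' p v) \<in> F)"
    and unique: "\<And>(f :: 'a \<Rightarrow> 'b) D D' p. p \<in> S \<Longrightarrow> (f has_derivative D) (at p within S) \<Longrightarrow>
                   (f has_derivative D') (at p within S) \<Longrightarrow> D = D'"
  shows "smooth_on S f"
proof -
  have "Ck_on k S f" if "f \<in> F" for k f
    using that
  proof (induction k arbitrary: f)
    case 0
    then obtain f' where "\<forall>p\<in>S. (f has_derivative f' p) (at p within S)"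
      using deriv by blast
    then show ?case
      using has_derivative_continuous_on[of S f f'] by simp
  next
    case (Suc k)
    obtain f' where f': "\<And>p. p \<in> S \<Longrightarrow> (f has_derivative f' p) (at p within S)"
      and F: "\<And>v. (\<lambda>p. f' p v) \<in> F"
      using deriv[OF Suc.prems] by blast
    \<comment> \<open>\<open>frechet_derivative\<close> is an arbitrary choice among the
      derivatives, so uniqueness within \<open>S\<close> is what identifies it with
      \<open>f' p\<close>.\<close>
    have "frechet_derivative f (at p within S) = f' p" if "p \<in> S" for p
    proof (rule unique[OF that _ f'[OF that]])
      show "(f has_derivative frechet_derivative f (at p within S)) (at p within S)"
        using f'[OF that] frechet_derivative_works differentiableI by blast
    qed
    then have "Ck_on k S (\<lambda>p. frechet_derivative f (at p within S) v)" for v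
      using Ck_on_cong[of S "\<lambda>p. frechet_derivative f (at p within S) v" "\<lambda>p. f' p v" k]
        Suc.IH[OF F] by simp
    moreover have "f differentiable_on S"
      using f' by (auto simp: differentiable_on_def differentiable_def)
    ultimately show ?case by simp
  qed
  then show ?thesis
    using \<open>f \<in> F\<close> by (simp add: smooth_on_def)
qed

text \<open>The constructors are chosen so that the class is closed under directional derivatives.
  In particular \<open>inverse_sqrt\<close> is the derivative of \<open>arsinh\<close>, and with r =
  1 / sqrt (1 + y^2) its own derivative is -y r^3, again in the class.\<close>

inductive_set elementary :: "('a::real_normed_vector \<Rightarrow> real) set" where
  const: "(\<lambda>p. c) \<in> elementary"
| linear: "bounded_linear L \<Longrightarrow> L \<in> elementary"
| add: "f \<in> elementary \<Longrightarrow> g \<in> elementary \<Longrightarrow> (\<lambda>p. f p + g p) \<in> elementary"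
| mult: "f \<in> elementary \<Longrightarrow> g \<in> elementary \<Longrightarrow> (\<lambda>p. f p * g p) \<in> elementary"
| exp: "f \<in> elementary \<Longrightarrow> (\<lambda>p. exp (f p)) \<in> elementary"
| sin: "f \<in> elementary \<Longrightarrow> (\<lambda>p. sin (f p)) \<in> elementary"
| cos: "f \<in> elementary \<Longrightarrow> (\<lambda>p. cos (f p)) \<in> elementary"
| arsinh: "f \<in> elementary \<Longrightarrow> (\<lambda>p. arsinh (f p)) \<in> elementary"
| inverse_sqrt: "f \<in> elementary \<Longrightarrow> (\<lambda>p. 1 / sqrt (1 + (f p)\<^sup>2)) \<in> elementary"

text \<open>The derivative is spelled out as a nested product because \<open>elementary\<close> has
  no rules for negation or powers; in this form \<open>elementary.mult\<close> and
  \<open>elementary.const\<close> apply directly.\<close>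

lemma has_real_derivative_inverse_sqrt:
  fixes y :: real
  defines "r \<equiv> 1 / sqrt (1 + y\<^sup>2)"
  shows "((\<lambda>y. 1 / sqrt (1 + y\<^sup>2)) has_real_derivative (- 1) * (y * (r * (r * r)))) (at y)"
proof -
  have pos: "1 + y\<^sup>2 > 0"
    by (simp add: add_pos_nonneg)
  have "((\<lambda>y. 1 / sqrt (1 + y\<^sup>2)) has_real_derivative
      - (2 * y * (inverse (sqrt (1 + y\<^sup>2)) / 2)) / (sqrt (1 + y\<^sup>2) * sqrt (1 + y\<^sup>2))) (at y)"
    using pos by (auto intro!: derivative_eq_intros)
  then show ?thesis
    by (simp add: r_def field_simps)
qed

text \<open>The chain rule, packaged once for all unary constructors \<open>exp\<close>,
  \<open>sin\<close>, \<open>cos\<close>, \<open>arsinh\<close> and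
  \<open>inverse_sqrt\<close>.\<close>

lemma elementary_chain:
  assumes f: "\<And>p. (f has_derivative f' p) (at p)" "\<And>v. (\<lambda>p. f' p v) \<in> elementary"
    and h: "\<And>y. (h has_real_derivative h' y) (at y)" "(\<lambda>p. h' (f p)) \<in> elementary"
  shows "\<exists>g'. (\<forall>p. ((\<lambda>p. h (f p)) has_derivative g' p) (at p)) \<and> (\<forall>v. (\<lambda>p. g' p v) \<in> elementary)"
proof (intro exI conjI allI)
  show "((\<lambda>p. h (f p)) has_derivative (\<lambda>v. h' (f p) * f' p v)) (at p)" for p
    using has_derivative_compose[OF f(1) h(1)[unfolded has_field_derivative_def]] .
  show "(\<lambda>p. h' (f p) * f' p v) \<in> elementary" for v
    by (intro elementary.mult h f)
qed

lemma elementary_has_derivative: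
  assumes "f \<in> elementary"
  shows "\<exists>f'. (\<forall>p. (f has_derivative f' p) (at p)) \<and> (\<forall>v. (\<lambda>p. f' p v) \<in> elementary)"
  using assms
proof induction
  case (const c)
  show ?case
    by (rule exI[of _ "\<lambda>p v. 0"]) (auto intro: elementary.const)
next
  case (linear L)
  then show ?case
    by (intro exI[of _ "\<lambda>p. L"]) (auto intro: elementary.const bounded_linear_imp_has_derivative)
next
  case (add f g)
  then obtain f' g'
    where "\<And>p. (f has_derivative f' p) (at p)" "\<And>v. (\<lambda>p. f' p v) \<in> elementary"
      and "\<And>p. (g has_derivative g' p) (at p)" "\<And>v. (\<lambda>p. g' p v) \<in> elementary"
    by blast
  then show ?case
    by (intro exI[of _ "\<lambda>p v. f' p v + g' p v"])
      (auto intro: elementary.add has_derivative_add)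
next
  case (mult f g)
  then obtain f' g'
    where "\<And>p. (f has_derivative f' p) (at p)" "\<And>v. (\<lambda>p. f' p v) \<in> elementary"
      and "\<And>p. (g has_derivative g' p) (at p)" "\<And>v. (\<lambda>p. g' p v) \<in> elementary"
    by blast
  with mult.hyps show ?case
    by (intro exI[of _ "\<lambda>p v. f p * g' p v + f' p v * g p"])
      (auto intro!: elementary.add elementary.mult has_derivative_mult)
next
  case (exp f)
  then obtain f' where f': "\<And>p. (f has_derivative f' p) (at p)" "\<And>v. (\<lambda>p. f' p v) \<in> elementary"
    by blast
  show ?case
    by (rule elementary_chain[OF f' DERIV_exp elementary.exp[OF exp.hyps]])
next
  case (sin f)
  then obtain f' where f': "\<And>p. (f has_derivative f' p) (at p)" "\<And>v. (\<lambda>p. f' p v) \<in> elementary"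
    by blast
  show ?case
    by (rule elementary_chain[OF f' DERIV_sin elementary.cos[OF sin.hyps]])
next
  case (cos f)
  then obtain f' where f': "\<And>p. (f has_derivative f' p) (at p)" "\<And>v. (\<lambda>p. f' p v) \<in> elementary"
    by blast
  have "(\<lambda>p. - sin (f p)) \<in> elementary"
    using elementary.mult[OF elementary.const[of "- 1"] elementary.sin[OF cos.hyps]] by simp
  then show ?case
    by (rule elementary_chain[OF f' DERIV_cos])
next
  case (arsinh f)
  then obtain f' where f': "\<And>p. (f has_derivative f' p) (at p)" "\<And>v. (\<lambda>p. f' p v) \<in> elementary"
    by blast
  have "(arsinh has_real_derivative 1 / sqrt (1 + y\<^sup>2)) (at y)" for y :: real
    using arsinh_real_has_field_derivative[of y UNIV] by (simp add: add.commute)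
  then show ?case
    by (rule elementary_chain[OF f' _ elementary.inverse_sqrt[OF arsinh.hyps]])
next
  case (inverse_sqrt f)
  then obtain f' where f': "\<And>p. (f has_derivative f' p) (at p)" "\<And>v. (\<lambda>p. f' p v) \<in> elementary"
    by blast
  show ?case
    by (rule elementary_chain[OF f' has_real_derivative_inverse_sqrt])
      (intro elementary.mult elementary.const elementary.inverse_sqrt inverse_sqrt.hyps)
qed

text \<open>Even at time 0 a small positive step along either coordinate axis stays in the
  half-plane, and a linear map is determined by its values on the axes.\<close>

lemma has_derivative_unique_half_plane:
  fixes p :: "real \<times> real"
  assumes "p \<in> UNIV \<times> {0..}"
    and "(f has_derivative D) (at p within UNIV \<times> {0..})"
    and "(f has_derivative D') (at p within UNIV \<times> {0..})"
  shows "D = D'"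
proof (rule frechet_derivative_unique_within[OF assms(2,3)])
  fix i :: "real \<times> real" and e :: real
  assume "i \<in> Basis" "e > 0"
  with assms(1) show "\<exists>d. 0 < \<bar>d\<bar> \<and> \<bar>d\<bar> < e \<and> p + d *\<^sub>R i \<in> UNIV \<times> {0..}"
    by (intro exI[of _ "e / 2"]) (auto simp: Basis_prod_def mem_Times_iff)
qed

lemma smooth_on_half_plane_elementary:
  fixes f :: "real \<times> real \<Rightarrow> real"
  assumes "f \<in> elementary"
  shows "smooth_on (UNIV \<times> {0..}) f"
proof (rule smooth_on_coinduct[OF assms])
  fix g :: "real \<times> real \<Rightarrow> real"
  assume "g \<in> elementary"
  then show "\<exists>g'. (\<forall>p\<in>UNIV \<times> {0..}. (g has_derivative g' p) (at p within UNIV \<times> {0..})) \<and>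
      (\<forall>v. (\<lambda>p. g' p v) \<in> elementary)"
    using elementary_has_derivative has_derivative_at_withinI by blast
qed (rule has_derivative_unique_half_plane)

section \<open>The hairclip solution\<close>

definition hairclip :: "real \<Rightarrow> real \<Rightarrow> real \<Rightarrow> real \<Rightarrow> real" where
  "hairclip m A x t = arsinh (A * exp (- m\<^sup>2 * t) * sin (m * x)) / m"

lemma has_real_derivative_arsinh_compose:
  assumes "(g has_real_derivative D) (at x within S)"
  shows "((\<lambda>x. arsinh (g x)) has_real_derivative 1 / sqrt ((g x)\<^sup>2 + 1) * D) (at x within S)"
  by (rule DERIV_chain2[OF arsinh_real_has_field_derivative assms])

lemma spatial_deriv_hairclip:
  fixes m A x t :: real
  assumes "m \<noteq> 0"
  defines "E \<equiv> A * exp (- m\<^sup>2 * t)"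
  shows "spatial_deriv (hairclip m A) x t = E * cos (m * x) / sqrt (1 + (E * sin (m * x))\<^sup>2)"
  unfolding spatial_deriv_def
proof (rule DERIV_imp_deriv)
  have "((\<lambda>y. arsinh (E * sin (m * y)) / m) has_real_derivative
      (1 / sqrt ((E * sin (m * x))\<^sup>2 + 1) * (E * (cos (m * x) * m))) / m) (at x)"
    by (intro DERIV_cdivide has_real_derivative_arsinh_compose DERIV_cmult)
      (auto intro!: derivative_eq_intros)
  then show "((\<lambda>y. hairclip m A y t) has_real_derivative
      E * cos (m * x) / sqrt (1 + (E * sin (m * x))\<^sup>2)) (at x)"
    using assms(1) by (simp add: hairclip_def E_def add.commute mult.assoc)
qed

text \<open>With E = A exp(-m^2 t), the identity sin^2 + cos^2 = 1 gives 1 + w_x^2 = (1 + E^2) / (1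
  + E^2 sin^2(m x)). The numerator is independent of x, which makes the curvature term
  explicit.\<close>

lemma graphical_mcf_hairclip:
  assumes m: "m \<noteq> 0"
  shows "graphical_mcf (hairclip m A)"
  unfolding graphical_mcf_def
proof (intro conjI allI impI)
  \<comment> \<open>Division by \<open>m\<close> is written as a constant factor, and the
    coordinates as the linear maps \<open>fst\<close> and \<open>snd\<close>, to match the
    constructors.\<close>
  have "(\<lambda>p::real \<times> real. 1 / m * arsinh (A * exp (- m\<^sup>2 * snd p) * sin (m * fst p))) \<in> elementary"
    by (intro elementary.intros bounded_linear_fst bounded_linear_snd)
  then show "smooth_on (UNIV \<times> {0..}) (\<lambda>(x, t). hairclip m A x t)"
    by (intro smooth_on_half_plane_elementary) (simp add: hairclip_def case_prod_unfold)
next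
  fix x t :: real
  define E where "E = A * exp (- m\<^sup>2 * t)"
  define s where "s y = sqrt (1 + (E * sin (m * y))\<^sup>2)" for y
  define q where "q = sqrt (1 + E\<^sup>2)"
  have s_pos: "s y > 0" for y
    by (simp add: s_def add_pos_nonneg)
  have q_pos: "q > 0"
    by (simp add: q_def add_pos_nonneg)
  have slope: "spatial_deriv (hairclip m A) y t = E * cos (m * y) / s y" for y
    using spatial_deriv_hairclip[OF m] by (simp add: E_def s_def)
  have length: "sqrt (1 + (spatial_deriv (hairclip m A) y t)\<^sup>2) = q / s y" for y
  proof -
    have "1 + (E * cos (m * y) / s y)\<^sup>2 = ((s y)\<^sup>2 + (E * cos (m * y))\<^sup>2) / (s y)\<^sup>2"
      using s_pos[of y] by (simp add: field_simps)
    also have "(s y)\<^sup>2 + (E * cos (m * y))\<^sup>2 = 1 + E\<^sup>2 * ((sin (m * y))\<^sup>2 + (cos (m * y))\<^sup>2)"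
      by (simp add: s_def distrib_left power_mult_distrib del: sin_cos_squared_add)
    also have "\<dots> = q\<^sup>2"
      by (simp add: q_def)
    finally show ?thesis
      using s_pos[of y] q_pos by (simp add: slope real_sqrt_divide)
  qed
  \<comment> \<open>The factor \<open>s y\<close> cancels, leaving a multiple of a cosine to
    differentiate.\<close>
  have "(\<lambda>y. spatial_deriv (hairclip m A) y t / sqrt (1 + (spatial_deriv (hairclip m A) y t)\<^sup>2))
      = (\<lambda>y. E * cos (m * y) / q)"
    unfolding length unfolding slope using s_pos by (simp add: less_imp_neq[symmetric])
  moreover have "deriv (\<lambda>y. E * cos (m * y) / q) x = - (m * E * sin (m * x) / q)"
    by (rule DERIV_imp_deriv) (use q_pos in \<open>auto intro!: derivative_eq_intros\<close>)
  ultimately have rhs: "sqrt (1 + (spatial_deriv (hairclip m A) x t)\<^sup>2) *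
      deriv (\<lambda>y. spatial_deriv (hairclip m A) y t / sqrt (1 + (spatial_deriv (hairclip m A) y t)\<^sup>2)) x
      = - (m * E * sin (m * x) / s x)"
    using q_pos by (simp add: length)
  have "((\<lambda>\<tau>. arsinh (A * exp (- m\<^sup>2 * \<tau>) * sin (m * x)) / m) has_real_derivative
      (1 / sqrt ((E * sin (m * x))\<^sup>2 + 1) * (A * (exp (- m\<^sup>2 * t) * - m\<^sup>2) * sin (m * x))) / m)
      (at t within {0..})"
    unfolding E_def
    by (intro DERIV_cdivide has_real_derivative_arsinh_compose DERIV_cmult_right DERIV_cmult)
      (auto intro!: derivative_eq_intros)
  moreover have "(1 / sqrt ((E * sin (m * x))\<^sup>2 + 1) * (A * (exp (- m\<^sup>2 * t) * - m\<^sup>2) * sin (m * x))) / m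
      = - (m * E * sin (m * x) / s x)"
    using m by (simp add: s_def E_def add.commute power2_eq_square)
  ultimately show "((\<lambda>\<tau>. hairclip m A x \<tau>) has_real_derivative
      sqrt (1 + (spatial_deriv (hairclip m A) x t)\<^sup>2) *
      deriv (\<lambda>y. spatial_deriv (hairclip m A) y t / sqrt (1 + (spatial_deriv (hairclip m A) y t)\<^sup>2)) x)
      (at t within {0..})"
    by (simp add: rhs hairclip_def)
qed

lemma sup_norm_hairclip_initial:
  assumes m: "m > 0" and "A \<ge> 0"
  shows "sup_norm_on UNIV (\<lambda>x. hairclip m A x 0) = ereal (arsinh A / m)"
  unfolding sup_norm_on_def
proof (rule antisym)
  have "\<bar>hairclip m A x 0\<bar> \<le> arsinh A / m" for x
  proof -
    have "\<bar>A * sin (m * x)\<bar> \<le> A"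
      using assms(2) by (simp add: abs_mult mult_left_le)
    then have "A * sin (m * x) \<le> A" "- (A * sin (m * x)) \<le> A"
      by linarith+
    then have "\<bar>arsinh (A * sin (m * x))\<bar> \<le> arsinh A"
      \<comment> \<open>Both bounds follow because \<open>arsinh\<close> is odd and
        increasing.\<close>
      unfolding abs_le_iff arsinh_minus_real[symmetric]
      by (simp add: not_less[symmetric] del: arsinh_minus_real)
    then show ?thesis
      using m by (simp add: hairclip_def divide_right_mono)
  qed
  then show "(SUP x. ereal \<bar>hairclip m A x 0\<bar>) \<le> ereal (arsinh A / m)"
    by (intro SUP_least) simp
  \<comment> \<open>The bound is attained at a quarter period, where the sine equals 1.\<close>
  have "ereal (arsinh A / m) \<le> ereal \<bar>hairclip m A (pi / 2 / m) 0\<bar>"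
    using m by (simp add: hairclip_def divide_right_mono)
  also have "\<dots> \<le> (SUP x. ereal \<bar>hairclip m A x 0\<bar>)"
    by (rule SUP_upper) simp
  finally show "ereal (arsinh A / m) \<le> (SUP x. ereal \<bar>hairclip m A x 0\<bar>)" .
qed

lemma slope_lower_bound:
  fixes l :: real
  assumes "l \<ge> 2"
  shows "l * exp (l\<^sup>2) \<le> sinh (7 * l\<^sup>2) * exp (- (4 * l\<^sup>2))"
proof -
  have l: "l \<le> l\<^sup>2"
    using assms by (simp add: power2_eq_square)
  \<comment> \<open>Twice the right-hand side of the goal is exp(3 l^2) - exp(-11 l^2). The summand
    1 pays for the subtracted exponential and is itself bounded by exp(l^2).\<close>
  have "2 * l * exp (l\<^sup>2) + 1 \<le> exp (l\<^sup>2) * (1 + 2 * l)"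
    by (simp add: algebra_simps)
  also have "\<dots> \<le> exp (l\<^sup>2) * exp (2 * l\<^sup>2)"
    using l by (intro mult_left_mono order_trans[OF _ exp_ge_add_one_self]) auto
  also have "\<dots> = exp (7 * l\<^sup>2) * exp (- (4 * l\<^sup>2))"
    by (simp flip: exp_add)
  finally have "2 * l * exp (l\<^sup>2) + 1 \<le> exp (7 * l\<^sup>2) * exp (- (4 * l\<^sup>2))" .
  moreover have "exp (- (7 * l\<^sup>2)) * exp (- (4 * l\<^sup>2)) \<le> 1"
    by (simp flip: exp_add)
  ultimately show ?thesis
    by (simp add: sinh_field_def algebra_simps)
qed

theorem proposition1:
  shows "\<exists>l0 > (1::real). \<forall>l \<ge> l0. \<exists>w :: real \<Rightarrow> real \<Rightarrow> real.
    graphical_mcf w \<and>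
    ereal (3 * l) < sup_norm_on UNIV (\<lambda>x. w x 0) \<and>
    sup_norm_on UNIV (\<lambda>x. w x 0) \<le> ereal (4 * l) \<and>
    ereal (l * exp (l\<^sup>2)) \<le> sup_norm_on {x. \<bar>x\<bar> \<le> exp (- (l\<^sup>2))} (\<lambda>x. spatial_deriv w x 1)"
proof (intro exI[of _ 2] conjI allI impI)
  fix l :: real
  assume l: "2 \<le> l"
  \<comment> \<open>For m = c l and height h l, the slope at the origin at time 1 is about exp((c h
    - c^2) l^2) / 2. The values c = 2 and h = 7/2 satisfy 3 < h <= 4 and give c h - c^2 = 3, which
    exceeds the required exponent 1.\<close>
  define w where "w = hairclip (2 * l) (sinh (7 * l\<^sup>2))"
  have "graphical_mcf w"
    using l unfolding w_def by (intro graphical_mcf_hairclip) simp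
  moreover have "sup_norm_on UNIV (\<lambda>x. w x 0) = ereal (7 * l / 2)"
    using l unfolding w_def
    by (subst sup_norm_hairclip_initial) (auto simp: arsinh_sinh_real power2_eq_square)
  moreover have "ereal (l * exp (l\<^sup>2)) \<le> sup_norm_on {x. \<bar>x\<bar> \<le> exp (- (l\<^sup>2))} (\<lambda>x. spatial_deriv w x 1)"
  proof -
    have "spatial_deriv w 0 1 = sinh (7 * l\<^sup>2) * exp (- (4 * l\<^sup>2))"
      using l unfolding w_def by (subst spatial_deriv_hairclip) auto
    then have "ereal (l * exp (l\<^sup>2)) \<le> ereal \<bar>spatial_deriv w 0 1\<bar>"
      using slope_lower_bound[OF l] by simp
    \<comment> \<open>The origin lies in the interval however small its radius.\<close>
    also have "\<dots> \<le> sup_norm_on {x. \<bar>x\<bar> \<le> exp (- (l\<^sup>2))} (\<lambda>x. spatial_deriv w x 1)"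
      unfolding sup_norm_on_def by (rule SUP_upper) simp
    finally show ?thesis .
  qed
  ultimately show "\<exists>w. graphical_mcf w \<and>
      ereal (3 * l) < sup_norm_on UNIV (\<lambda>x. w x 0) \<and>
      sup_norm_on UNIV (\<lambda>x. w x 0) \<le> ereal (4 * l) \<and>
      ereal (l * exp (l\<^sup>2)) \<le> sup_norm_on {x. \<bar>x\<bar> \<le> exp (- (l\<^sup>2))} (\<lambda>x. spatial_deriv w x 1)"
    using l by (intro exI[of _ w]) simp
qed simp

end
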